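(* Let $m\le M$ be real numbers, let $x_1,\dots,x_n$ be real numbers with $m\le x_i\le M$ for $i=1,\dots,n$, and let $p_1,\dots,p_n\ge 0$ with $\sum_{i=1}^n p_i=1$. Let $\mu_1'=\sum_{i=1}^n p_i x_i$, $\mu_2=\sum_{i=1}^n p_i(x_i-\mu_1')^2$ and $\mu_4=\sum_{i=1}^n p_i(x_i-\mu_1')^4$. Then $$\mu_2\mu_4\le \frac{4}{3^5}(M-m)^6.$$
   Context: The numbers $x_i$ are the values of a discrete random variable, taken with probabilities $p_i$; $\mu_1'$ is its mean and $\mu_r$ its $r$-th central moment. *)

theory Defs
  imports Complex_Main
begin

text \<open>Moments of the discrete distribution taking the value \<open>x i\<close> with probability \<open>p i\<close>,
  for \<open>i = 1, \<dots>, n\<close>; the values \<open>x i\<close> need not be distinct.\<close>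

definition mean :: "nat \<Rightarrow> (nat \<Rightarrow> real) \<Rightarrow> (nat \<Rightarrow> real) \<Rightarrow> real" where
  "mean n p x = (\<Sum>i=1..n. p i * x i)"

definition central_moment :: "nat \<Rightarrow> nat \<Rightarrow> (nat \<Rightarrow> real) \<Rightarrow> (nat \<Rightarrow> real) \<Rightarrow> real" where
  "central_moment r n p x = (\<Sum>i=1..n. p i * (x i - mean n p x) ^ r)"

end

theory Submission
  imports Defs
begin

text \<open>On \<open>[-a, b]\<close> with \<open>a = mean - m\<close> and \<open>b = M - mean\<close>, the convex functions \<open>y\<^sup>2\<close> and \<open>y\<^sup>4\<close> lie
  below their chords. The centred variable has expectation 0, so only the chords' values at 0 survive:
  with \<open>t = a b\<close> and \<open>D = a + b = M - m\<close>, the second moment is at most \<open>t\<close> and the fourth at most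
  \<open>t (D\<^sup>2 - 3 t)\<close>. The product \<open>t\<^sup>2 (D\<^sup>2 - 3 t)\<close> is largest at \<open>t = 2 D\<^sup>2 / 9\<close>.\<close>

lemma central_moment_le_affine:
  assumes "\<And>i. i \<in> {1..n} \<Longrightarrow> 0 \<le> p i"
    and "(\<Sum>i=1..n. p i) = 1"
    and "\<And>i. i \<in> {1..n} \<Longrightarrow> (x i - mean n p x) ^ r \<le> c * (x i - mean n p x) + d"
  shows "central_moment r n p x \<le> d"
proof -
  let ?\<mu> = "mean n p x"
  have "central_moment r n p x \<le> (\<Sum>i=1..n. p i * (c * (x i - ?\<mu>) + d))"
    unfolding central_moment_def using assms(1,3) by (intro sum_mono mult_left_mono) auto
  also have "\<dots> = (\<Sum>i=1..n. c * (p i * x i) + (d - c * ?\<mu>) * p i)"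
    by (intro sum.cong) (auto simp: algebra_simps)
  also have "\<dots> = c * ?\<mu> + (d - c * ?\<mu>) * (\<Sum>i=1..n. p i)"
    by (simp add: sum.distrib mean_def flip: sum_distrib_left)
  also have "\<dots> = d"
    using assms(2) by simp
  finally show ?thesis .
qed

lemma central_moment_even_nonneg:
  assumes "\<And>i. i \<in> {1..n} \<Longrightarrow> 0 \<le> p i" and "even r"
  shows "0 \<le> central_moment r n p x"
  unfolding central_moment_def using assms
  by (intro sum_nonneg mult_nonneg_nonneg) (auto simp: zero_le_even_power)

lemma square_le_chord:
  fixes a b y :: real
  assumes "- a \<le> y" "y \<le> b"
  shows "y ^ 2 \<le> (b - a) * y + a * b"
proof -
  \<comment> \<open>This product is exactly the chord minus \<open>y ^ 2\<close>.\<close>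
  have "0 \<le> (y + a) * (b - y)"
    using assms by simp
  then show ?thesis
    by (simp add: algebra_simps power2_eq_square)
qed

text \<open>The chord minus \<open>y ^ 4\<close> vanishes at \<open>- a\<close> and
  \<open>b\<close>, so \<open>(y + a) * (b - y)\<close> splits off; the quadratic cofactor is half a
  sum of three squares.\<close>

lemma fourth_power_le_chord:
  fixes a b y :: real
  assumes "- a \<le> y" "y \<le> b"
  shows "y ^ 4 \<le> ((b - a) * (a ^ 2 + b ^ 2)) * y + a * b * ((a + b) ^ 2 - 3 * (a * b))"
proof -
  have "0 \<le> (y + b) ^ 2 + (y - a) ^ 2 + (a - b) ^ 2"
    by simp
  then have "0 \<le> y ^ 2 + (b - a) * y + (a ^ 2 - a * b + b ^ 2)"
    by (simp add: algebra_simps power2_eq_square)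
  then have "0 \<le> ((y + a) * (b - y)) * (y ^ 2 + (b - a) * y + (a ^ 2 - a * b + b ^ 2))"
    using assms by simp
  also have "\<dots> = ((b - a) * (a ^ 2 + b ^ 2)) * y + a * b * ((a + b) ^ 2 - 3 * (a * b)) - y ^ 4"
    by algebra
  finally show ?thesis
    by simp
qed

lemma cubic_le_max:
  fixes t D :: real
  assumes "0 \<le> t"
  shows "t * (t * (D ^ 2 - 3 * t)) \<le> 4 / 3 ^ 5 * D ^ 6"
proof -
  \<comment> \<open>The gap to the maximum has a double root at the maximiser; its third root is
    \<open>- (D ^ 2) / 9\<close>.\<close>
  have "0 \<le> 3 * (t - 2 * D ^ 2 / 9) ^ 2 * (t + D ^ 2 / 9)"
    using assms by simp
  also have "\<dots> = 4 / 3 ^ 5 * D ^ 6 - t * (t * (D ^ 2 - 3 * t))"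
    by (simp add: field_simps eval_nat_numeral)
  finally show ?thesis
    by simp
qed

theorem theorem2p5:
  fixes m M :: real and n :: nat and x p :: "nat \<Rightarrow> real"
  assumes "m \<le> M"
    and "\<And>i. i \<in> {1..n} \<Longrightarrow> m \<le> x i \<and> x i \<le> M"
    and "\<And>i. i \<in> {1..n} \<Longrightarrow> 0 \<le> p i"
    and "(\<Sum>i=1..n. p i) = 1"
  shows "central_moment 2 n p x * central_moment 4 n p x \<le> 4 / 3 ^ 5 * (M - m) ^ 6"
proof -
  define a b where "a = mean n p x - m" and "b = M - mean n p x"
  have range: "- a \<le> x i - mean n p x" "x i - mean n p x \<le> b" if "i \<in> {1..n}" for i
    using assms(2)[OF that] by (auto simp: a_def b_def)
  have \<mu>2: "central_moment 2 n p x \<le> a * b"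
    using assms(3,4) square_le_chord[OF range] by (rule central_moment_le_affine)
  have \<mu>4: "central_moment 4 n p x \<le> a * b * ((a + b) ^ 2 - 3 * (a * b))"
    using assms(3,4) fourth_power_le_chord[OF range] by (rule central_moment_le_affine)
  have "0 \<le> central_moment 2 n p x" and \<mu>4_nonneg: "0 \<le> central_moment 4 n p x"
    using assms(3) by (auto intro: central_moment_even_nonneg)
  \<comment> \<open>The sign comes from the variance bound, so
    \<open>m \<le> mean n p x \<le> M\<close> need not be shown.\<close>
  with \<mu>2 have ab: "0 \<le> a * b"
    by simp
  have "central_moment 2 n p x * central_moment 4 n p x
      \<le> a * b * (a * b * ((a + b) ^ 2 - 3 * (a * b)))"
    by (rule mult_mono[OF \<mu>2 \<mu>4 ab \<mu>4_nonneg])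
  also have "\<dots> \<le> 4 / 3 ^ 5 * (a + b) ^ 6"
    by (rule cubic_le_max[OF ab])
  also have "a + b = M - m"
    by (simp add: a_def b_def)
  finally show ?thesis .
qed

end
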